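(* Let $n\ge 1$ and let $\sigma$ be a permutation of $\{1,\dots,n\}$. For every non-terminal position $w\in\mathcal{W}_+$ of Partizan-Serial-Nim, the following hold. (i) If $w\in\mathcal{W}_{=}$, then $$L(w)=\begin{cases}0 & \text{if } o(w_\ast)=\mathcal{L},\\ \infty & \text{if } o(w_\ast)=\mathcal{R},\\ 0 & \text{if } o(w_\ast)=\mathcal{P},\\ 1 & \text{if } o(w_\ast)=\mathcal{N},\end{cases}\qquad R(w)=\begin{cases}\infty & \text{if } o(w_\ast)=\mathcal{L},\\ 0 & \text{if } o(w_\ast)=\mathcal{R},\\ 0 & \text{if } o(w_\ast)=\mathcal{P},\\ 1 & \text{if } o(w_\ast)=\mathcal{N}.\end{cases}$$ (ii) If $w\in\mathcal{W}_{\neq}$, then $$L(w)=\begin{cases}0 & \text{if } \beta(w)\le R(w_L),\\ L(w_R)+(\beta(w)-R(w_L)) & \text{if } \beta(w)>R(w_L),\end{cases}$$ $$R(w)=\begin{cases}0 & \text{if } \alpha(w)\le L(w_R),\\ R(w_L)+(\alpha(w)-L(w_R)) & \text{if } \alpha(w)>L(w_R).\end{cases}$$ (iii) We have $$o(w)=\begin{cases}\mathcal{L} & \text{if } \alpha(w)>L(w),\ \beta(w)\le R(w),\\ \mathcal{R} & \text{if } \alpha(w)\le L(w),\ \beta(w)>R(w),\\ \mathcal{N} & \text{if } \alpha(w)>L(w),\ \beta(w)>R(w),\\ \mathcal{P} & \text{if } \alpha(w)\le L(w),\ \beta(w)\le R(w).\end{cases}$$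
   Context: Partizan-Serial-Nim: fix an integer $n\ge1$ and a permutation $\sigma$ of $[n]=\{1,\dots,n\}$. Positions are the elements of $\mathcal{W}=\{(w_1,\dots,w_n): w_i\in\mathbb{Z}_{\ge0}\}$ ($w_i$ is the number of stones in pile $i$); $\mathbf{0}=(0,\dots,0)$ is the only terminal position and $\mathcal{W}_+=\mathcal{W}\setminus\{\mathbf{0}\}$. For $w\in\mathcal{W}_+$, Left's target pile is $l(w)=\min\{i: w_i>0\}$ and Right's target pile $r(w)$ is the index $i$ with $w_i>0$ minimizing $\sigma(i)$. Put $\alpha(w)=w_{l(w)}$ and $\beta(w)=w_{r(w)}$. For $\gamma\in\mathbb{Z}_{\ge0}$, $w\langle\gamma,\cdot\rangle$ (resp. $w\langle\cdot,\gamma\rangle$) is the position obtained from $w$ by replacing the $l(w)$-th (resp. $r(w)$-th) entry by $\gamma$. The Left options of $w$ are $w\langle\alpha',\cdot\rangle$ for $0\le\alpha'<\alpha(w)$, and the Right options are $w\langle\cdot,\beta'\rangle$ for $0\le\beta'<\beta(w)$. Players alternate and the player who cannot move loses (normal play). Outcomes: $o(w)=\mathcal{L}$ (resp. $\mathcal{R}$) if Left (resp. Right) wins under optimal play no matter who plays first; $o(w)=\mathcal{N}$ if the player moving first wins; $o(w)=\mathcal{P}$ if the player moving second wins. The symbols $\mathcal{L},\mathcal{R},\mathcal{N},\mathcal{P}$ also denote the sets of positions with that outcome. $\mathcal{W}_{=}=\{w\in\mathcal{W}_+: l(w)=r(w)\}$ and $\mathcal{W}_{\neq}=\{w\in\mathcal{W}_+: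 l(w)\ne r(w)\}$. For $w\in\mathcal{W}_+$, $w_L=w\langle0,\cdot\rangle$ and $w_R=w\langle\cdot,0\rangle$; if $w\in\mathcal{W}_{=}$ these coincide and are denoted $w_\ast$. (If $w\in\mathcal{W}_{\neq}$ then $w_L,w_R\in\mathcal{W}_+$.) Thresholds: for $w\in\mathcal{W}_+$, $L(w)=\min\{\gamma\in\mathbb{Z}_{\ge0}: w\langle\gamma,\cdot\rangle\in\mathcal{L}\cup\mathcal{P}\}$ and $R(w)=\min\{\gamma\in\mathbb{Z}_{\ge0}: w\langle\cdot,\gamma\rangle\in\mathcal{R}\cup\mathcal{P}\}$, with value $\infty$ when no such $\gamma$ exists; the usual conventions $k<\infty$ and $\infty+k=\infty$ for integers $k$ are used. *)

theory Defs
  imports "HOL-Library.Extended_Nat" "HOL-Combinatorics.Permutations"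
begin

text \<open>
  Partizan-Serial-Nim on piles \<open>1, \<dots>, n\<close>, ordered for Left by the natural order and for Right by a
  permutation \<open>\<sigma>\<close> of \<open>{1..n}\<close>. A position, i.e. an \<open>n\<close>-tuple of natural numbers, is encoded as a
  function that vanishes outside \<open>{1..n}\<close>.
\<close>

type_synonym position = "nat \<Rightarrow> nat"

definition positions :: "nat \<Rightarrow> position set" where
  "positions n = {w. \<forall>i. i \<notin> {1..n} \<longrightarrow> w i = 0}"

definition terminal :: position where
  "terminal = (\<lambda>i. 0)"

definition positions_plus :: "nat \<Rightarrow> position set" where
  "positions_plus n = positions n - {terminal}"

text \<open>
  The target piles are meaningful for non-terminal positions only. For the terminal one both are
  unspecified, but \<open>\<alpha>\<close> and \<open>\<beta>\<close> are 0 all the same, so that it has no options below.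
\<close>

definition left_target :: "position \<Rightarrow> nat" where
  "left_target w = (LEAST i. 0 < w i)"

definition right_target :: "(nat \<Rightarrow> nat) \<Rightarrow> position \<Rightarrow> nat" where
  "right_target \<sigma> w = (ARG_MIN \<sigma> i. 0 < w i)"

definition left_stones :: "position \<Rightarrow> nat" ("\<alpha>") where
  "\<alpha> w = w (left_target w)"

definition right_stones :: "(nat \<Rightarrow> nat) \<Rightarrow> position \<Rightarrow> nat" ("\<beta>") where
  "\<beta> \<sigma> w = w (right_target \<sigma> w)"

definition left_replace :: "position \<Rightarrow> nat \<Rightarrow> position" where
  "left_replace w \<gamma> = w(left_target w := \<gamma>)"

definition right_replace :: "(nat \<Rightarrow> nat) \<Rightarrow> position \<Rightarrow> nat \<Rightarrow> position" where
  "right_replace \<sigma> w \<gamma> = w(right_target \<sigma> w := \<gamma>)"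

datatype player = Left | Right

fun opponent :: "player \<Rightarrow> player" where
  "opponent Left = Right"
| "opponent Right = Left"

fun options :: "(nat \<Rightarrow> nat) \<Rightarrow> player \<Rightarrow> position \<Rightarrow> position set" where
  "options \<sigma> Left w = {left_replace w a |a. a < \<alpha> w}"
| "options \<sigma> Right w = {right_replace \<sigma> w b |b. b < \<beta> \<sigma> w}"

text \<open>
  \<open>wins \<sigma> X Y w\<close>: player \<open>X\<close> can force a win from \<open>w\<close> when player \<open>Y\<close> moves next. Under normal play
  a player to move without an option has lost; accordingly the premise of the rule \<open>reply\<close> is
  vacuous there, whereas the rule \<open>move\<close> does not apply.
\<close>

inductive wins :: "(nat \<Rightarrow> nat) \<Rightarrow> player \<Rightarrow> player \<Rightarrow> position \<Rightarrow> bool" for \<sigma> where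
  move: "w' \<in> options \<sigma> X w \<Longrightarrow> wins \<sigma> X (opponent X) w' \<Longrightarrow> wins \<sigma> X X w"
| reply: "(\<And>w'. w' \<in> options \<sigma> (opponent X) w \<Longrightarrow> wins \<sigma> X X w') \<Longrightarrow> wins \<sigma> X (opponent X) w"

datatype outcome = Out_L | Out_R | Out_N | Out_P

fun has_outcome :: "(nat \<Rightarrow> nat) \<Rightarrow> position \<Rightarrow> outcome \<Rightarrow> bool" where
  "has_outcome \<sigma> w Out_L \<longleftrightarrow> (\<forall>Y. wins \<sigma> Left Y w)"
| "has_outcome \<sigma> w Out_R \<longleftrightarrow> (\<forall>Y. wins \<sigma> Right Y w)"
| "has_outcome \<sigma> w Out_N \<longleftrightarrow> (\<forall>Y. wins \<sigma> Y Y w)"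
| "has_outcome \<sigma> w Out_P \<longleftrightarrow> (\<forall>Y. wins \<sigma> (opponent Y) Y w)"

text \<open>Well-defined on all positions by the lemma \<open>ex1_outcome\<close> below.\<close>

definition outcome :: "(nat \<Rightarrow> nat) \<Rightarrow> position \<Rightarrow> outcome" where
  "outcome \<sigma> w = (THE c. has_outcome \<sigma> w c)"

definition positions_eq :: "nat \<Rightarrow> (nat \<Rightarrow> nat) \<Rightarrow> position set" where
  "positions_eq n \<sigma> = {w \<in> positions_plus n. left_target w = right_target \<sigma> w}"

definition positions_neq :: "nat \<Rightarrow> (nat \<Rightarrow> nat) \<Rightarrow> position set" where
  "positions_neq n \<sigma> = {w \<in> positions_plus n. left_target w \<noteq> right_target \<sigma> w}"

definition left_removed :: "position \<Rightarrow> position" where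
  "left_removed w = left_replace w 0"

definition right_removed :: "(nat \<Rightarrow> nat) \<Rightarrow> position \<Rightarrow> position" where
  "right_removed \<sigma> w = right_replace \<sigma> w 0"

lemma right_removed_eq_left_removed:
  "w \<in> positions_eq n \<sigma> \<Longrightarrow> right_removed \<sigma> w = left_removed w"
  by (simp add: positions_eq_def right_removed_def left_removed_def left_replace_def
      right_replace_def)

definition left_threshold :: "(nat \<Rightarrow> nat) \<Rightarrow> position \<Rightarrow> enat" where
  "left_threshold \<sigma> w =
    (if \<exists>\<gamma>. outcome \<sigma> (left_replace w \<gamma>) \<in> {Out_L, Out_P}
     then enat (LEAST \<gamma>. outcome \<sigma> (left_replace w \<gamma>) \<in> {Out_L, Out_P})
     else \<infinity>)"

definition right_threshold :: "(nat \<Rightarrow> nat) \<Rightarrow> position \<Rightarrow> enat" where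
  "right_threshold \<sigma> w =
    (if \<exists>\<gamma>. outcome \<sigma> (right_replace \<sigma> w \<gamma>) \<in> {Out_R, Out_P}
     then enat (LEAST \<gamma>. outcome \<sigma> (right_replace \<sigma> w \<gamma>) \<in> {Out_R, Out_P})
     else \<infinity>)"

lemma opponent_opponent [simp]: "opponent (opponent X) = X"
  by (cases X) auto

lemma opponent_neq [simp]: "opponent X \<noteq> X" "X \<noteq> opponent X"
  by (cases X; simp)+

lemma neq_opponent: "Y \<noteq> X \<Longrightarrow> Y = opponent X"
  by (cases X; cases Y) auto

lemma wins_self_iff:
  "wins \<sigma> X X w \<longleftrightarrow> (\<exists>w' \<in> options \<sigma> X w. wins \<sigma> X (opponent X) w')"
  by (subst wins.simps) auto

lemma wins_opponent_iff:
  "wins \<sigma> X (opponent X) w \<longleftrightarrow> (\<forall>w' \<in> options \<sigma> (opponent X) w. wins \<sigma> X X w')"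
  by (subst wins.simps) auto

lemma positive_entry_in_piles: "w \<in> positions n \<Longrightarrow> 0 < w i \<Longrightarrow> i \<in> {1..n}"
  by (auto simp: positions_def)

lemma replace_decreases:
  assumes "w \<in> positions n" "c < w i"
  shows "w(i := c) \<in> positions n" "sum (w(i := c)) {1..n} < sum w {1..n}"
proof -
  have i: "i \<in> {1..n}"
    using positive_entry_in_piles[OF assms(1)] assms(2) by (metis gr0I not_less0)
  show "w(i := c) \<in> positions n"
    using assms(1) i by (auto simp: positions_def)
  show "sum (w(i := c)) {1..n} < sum w {1..n}"
    by (rule sum_strict_mono_ex1) (use i assms(2) in auto)
qed

lemma options_decrease:
  assumes "w \<in> positions n" "w' \<in> options \<sigma> X w"
  shows "w' \<in> positions n" "sum w' {1..n} < sum w {1..n}"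
  using assms replace_decreases[OF assms(1)]
  by (cases X; auto simp: left_replace_def right_replace_def left_stones_def right_stones_def)+

lemma wins_determined:
  "w \<in> positions n \<Longrightarrow> wins \<sigma> (opponent X) Y w \<longleftrightarrow> \<not> wins \<sigma> X Y w"
proof (induction "sum w {1..n}" arbitrary: w X Y rule: less_induct)
  case less
  have IH: "wins \<sigma> (opponent Z) V w' \<longleftrightarrow> \<not> wins \<sigma> Z V w'" if "w' \<in> options \<sigma> U w" for w' U V Z
    using less.hyps options_decrease[OF less.prems that] by blast
  have *: "wins \<sigma> (opponent Z) Z w \<longleftrightarrow> \<not> wins \<sigma> Z Z w" for Z
    using wins_opponent_iff[of \<sigma> "opponent Z" w] wins_self_iff[of \<sigma> Z w] IH by auto
  show ?case
    using *[of X] *[of "opponent X"] neq_opponent[of Y X] by (cases "Y = X") auto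
qed

lemma ex1_outcome:
  assumes "w \<in> positions n"
  shows "\<exists>!c. has_outcome \<sigma> w c"
proof -
  have all: "(\<forall>Y. P Y) \<longleftrightarrow> P Left \<and> P Right" for P
    by (metis player.exhaust)
  have R: "wins \<sigma> Right Y w \<longleftrightarrow> \<not> wins \<sigma> Left Y w" for Y
    using wins_determined[OF assms, of \<sigma> Left Y] by simp
  have "\<exists>c. has_outcome \<sigma> w c"
  proof -
    have "has_outcome \<sigma> w Out_L \<or> has_outcome \<sigma> w Out_R \<or> has_outcome \<sigma> w Out_N \<or> has_outcome \<sigma> w Out_P"
      by (simp add: all R) blast
    then show ?thesis
      by blast
  qed
  moreover have "c = d" if "has_outcome \<sigma> w c" "has_outcome \<sigma> w d" for c d
    using that by (cases c; cases d; simp add: all R)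
  ultimately show ?thesis
    by blast
qed

end

theory Submission
  imports Defs
begin

text \<open>
  Only two facts about a position \<open>w\<close> matter: whether Left wins moving first and whether Right does.
  A threshold is the least \<open>\<gamma>\<close> for which the opponent, moving first in the position with the target
  pile set to \<open>\<gamma>\<close>, does not win. Moving first, Left wins exactly if one of her options has this
  property, that is, if \<open>L(w) < \<alpha>(w)\<close>; likewise for Right. This is the outcome table.

  As long as the target piles stay nonempty, play changes only them, so let these piles vary and fix
  the rest of the position. If both players aim at the same pile, then either of them may empty it at
  once, and the outcome of \<open>w\<^sub>*\<close> decides everything. The value 1 arises for \<open>\<N>\<close>: with a single
  stone left, the player to move has to hand over a position that is won by moving first.

  If the targets differ, let \<open>a\<close> and \<open>b\<close> be the sizes of Left's and Right's pile, and put
  \<open>\<mu> = L(w\<^sub>R)\<close> and \<open>\<rho> = R(w\<^sub>L)\<close>. Left wins by emptying her pile if \<open>b \<le> \<rho>\<close>, and Right by emptying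
  his if \<open>a \<le> \<mu>\<close>. Hence, once \<open>a > \<mu>\<close> and \<open>b > \<rho>\<close>, whoever goes down to the own threshold or below
  it loses, and the surpluses \<open>a - \<mu>\<close> and \<open>b - \<rho>\<close> are reserves of moves. The player to move wins
  exactly if the own surplus is the larger one, namely by making the two surpluses equal. The lemma
  \<open>two_pile_outcomes\<close> says this, by induction on \<open>a + b\<close>. The threshold is the size \<open>\<mu> + (b - \<rho>)\<close> at
  which the surpluses agree. All of it is symmetric in the two players, so each arithmetical fact is
  proved for one of them and used twice.
\<close>

section \<open>Least indices in the extended naturals\<close>

definition least_index :: "(nat \<Rightarrow> bool) \<Rightarrow> enat" where
  "least_index P = (if \<exists>c. P c then enat (LEAST c. P c) else \<infinity>)"

lemma least_index_less_iff: "least_index P < enat a \<longleftrightarrow> (\<exists>c<a. P c)"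
  unfolding least_index_def by (auto intro: LeastI2_ex Least_le le_less_trans)

lemma enat_eqI_less:
  fixes s t :: enat
  assumes "\<And>a. s < enat a \<longleftrightarrow> t < enat a"
  shows "s = t"
  using assms[of "Suc (the_enat s)"] assms[of "Suc (the_enat t)"] by (cases s; cases t) auto

section \<open>Who wins moving first, as a recursion on pile sizes\<close>

text \<open>
  In this section \<open>F\<close> and \<open>G\<close> tell whether the one player or the other wins moving first, as
  functions of the sizes of the target piles. A player whose pile has become empty aims elsewhere,
  so the recursion for this player is stated for a nonempty pile.
\<close>

text \<open>
  At any size \<open>c > 0\<close>, moving first wins for \<open>G\<close> by emptying the pile unless \<open>F 0\<close>. If \<open>F 0\<close>, then this
  move fails, and at size 1 there is no other.
\<close>

lemma one_pile_threshold:
  assumes G: "\<And>c. 0 < c \<Longrightarrow> G c \<longleftrightarrow> (\<exists>c'<c. \<not> F c')"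
  shows "least_index (\<lambda>c. \<not> G c) = (if \<not> G 0 then 0 else if F 0 then 1 else \<infinity>)"
proof -
  consider "\<not> G 0" | "G 0" "F 0" | "G 0" "\<not> F 0"
    by blast
  then show ?thesis
  proof cases
    case 1
    then have "(LEAST c. \<not> G c) = 0"
      by (intro Least_equality) auto
    with 1 show ?thesis
      by (auto simp: least_index_def zero_enat_def)
  next
    case 2
    then have "\<not> G 1"
      using G[of 1] by auto
    moreover have "(LEAST c. \<not> G c) = 1"
    proof (rule Least_equality)
      fix c
      assume "\<not> G c"
      with 2 show "1 \<le> c"
        by (cases c) auto
    qed (fact \<open>\<not> G 1\<close>)
    ultimately show ?thesis
      using 2 by (auto simp: least_index_def one_enat_def)
  next
    case 3
    then have "G c" for c
      using G[of c] by (cases "c = 0") auto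
    with 3 show ?thesis
      by (simp add: least_index_def)
  qed
qed

text \<open>
  The induction step for two piles, for one of the players. If emptying the pile does not win, then
  the winning moves are those to an \<open>a'\<close> whose surplus over \<open>\<mu>\<close> is at least the opponent's surplus
  over \<open>\<rho>\<close>. The least such \<open>a'\<close> is \<open>\<mu> + (b - \<rho>)\<close>, where both surpluses agree.
\<close>

lemma two_pile_step:
  fixes \<mu> \<rho> :: enat
  assumes "0 < a"
    and F: "F \<longleftrightarrow> (\<exists>a'<a. \<not> G a')"
    and G_zero: "G 0 \<longleftrightarrow> \<rho> < enat b"
    and G_pos: "\<And>a'. 0 < a' \<Longrightarrow> a' < a \<Longrightarrow>
      G a' \<longleftrightarrow> enat a' \<le> \<mu> \<or> \<rho> + (enat a' - \<mu>) < enat b"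
  shows "F \<longleftrightarrow> enat b \<le> \<rho> \<or> \<mu> + (enat b - \<rho>) < enat a"
proof (cases "enat b \<le> \<rho>")
  case True
  then show ?thesis
    using \<open>0 < a\<close> F G_zero by (auto simp: not_less)
next
  case False
  then obtain p where p: "\<rho> = enat p" "p < b"
    by (cases \<rho>) auto
  show ?thesis
  proof (cases \<mu>)
    case (enat q)
    have "(\<exists>a'<a. \<not> G a') \<longleftrightarrow> q + (b - p) < a"
    proof
      assume "\<exists>a'<a. \<not> G a'"
      then obtain a' where a': "a' < a" "\<not> G a'"
        by blast
      with G_zero p have "0 < a'"
        by (cases a') auto
      with a' G_pos[of a'] enat p show "q + (b - p) < a"
        by auto
    next
      assume *: "q + (b - p) < a"
      then show "\<exists>a'<a. \<not> G a'"
        using G_pos[of "q + (b - p)"] enat p by (intro exI[of _ "q + (b - p)"]) auto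
    qed
    with F enat p show ?thesis
      by auto
  next
    case infinity
    have "G a'" if "a' < a" for a'
      using G_zero G_pos[of a'] that infinity p by (cases "a' = 0") auto
    with F infinity p show ?thesis
      by auto
  qed
qed

text \<open>
  Here \<open>\<mu>\<close> and \<open>\<rho>\<close> are the thresholds at an empty opposite pile. They describe the two edges \<open>b = 0\<close>
  and \<open>a = 0\<close> of the quadrant, from which the outcomes in its interior follow by induction.
\<close>

lemma two_pile_outcomes:
  fixes F G :: "nat \<Rightarrow> nat \<Rightarrow> bool"
  assumes F: "\<And>a b. 0 < a \<Longrightarrow> F a b \<longleftrightarrow> (\<exists>a'<a. \<not> G a' b)"
    and G: "\<And>a b. 0 < b \<Longrightarrow> G a b \<longleftrightarrow> (\<exists>b'<b. \<not> F a b')"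
  defines "\<mu> \<equiv> least_index (\<lambda>a. \<not> G a 0)" and "\<rho> \<equiv> least_index (\<lambda>b. \<not> F 0 b)"
  assumes "0 < a" "0 < b"
  shows "(F a b \<longleftrightarrow> enat b \<le> \<rho> \<or> \<mu> + (enat b - \<rho>) < enat a) \<and>
    (G a b \<longleftrightarrow> enat a \<le> \<mu> \<or> \<rho> + (enat a - \<mu>) < enat b)"
  using \<open>0 < a\<close> \<open>0 < b\<close>
proof (induction "a + b" arbitrary: a b rule: less_induct)
  case less
  have "F a 0 \<longleftrightarrow> \<mu> < enat a" "G 0 b \<longleftrightarrow> \<rho> < enat b"
    using F[of a 0] G[of b 0] less.prems by (simp_all add: \<mu>_def \<rho>_def least_index_less_iff)
  then show ?case
    using less
    by (intro conjI two_pile_step[where G = "\<lambda>a. G a b", OF _ F]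
        two_pile_step[where G = "\<lambda>b. F a b", OF _ G]) simp_all
qed

text \<open>
  For \<open>a > 0\<close> the right-hand side of the recursion for \<open>F a b\<close> says that the threshold lies below
  \<open>a\<close>, so the threshold can be read off the formula for \<open>F\<close>.
\<close>

lemma two_pile_threshold:
  fixes F G :: "nat \<Rightarrow> nat \<Rightarrow> bool"
  assumes F: "\<And>a b. 0 < a \<Longrightarrow> F a b \<longleftrightarrow> (\<exists>a'<a. \<not> G a' b)"
    and G: "\<And>a b. 0 < b \<Longrightarrow> G a b \<longleftrightarrow> (\<exists>b'<b. \<not> F a b')"
    and "0 < b"
  shows "least_index (\<lambda>a. \<not> G a b) =
    (if enat b \<le> least_index (\<lambda>b. \<not> F 0 b) then 0
     else least_index (\<lambda>a. \<not> G a 0) + (enat b - least_index (\<lambda>b. \<not> F 0 b)))"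
    (is "?t = ?u")
proof (rule enat_eqI_less)
  fix a
  show "?t < enat a \<longleftrightarrow> ?u < enat a"
  proof (cases "a = 0")
    case True
    then show ?thesis
      by (simp flip: zero_enat_def)
  next
    case False
    then show ?thesis
      using two_pile_outcomes[of F G a b, OF F G] F[of a b] \<open>0 < b\<close>
      by (simp add: least_index_less_iff zero_enat_def)
  qed
qed

section \<open>Outcomes and thresholds in terms of the player moving first\<close>

lemma outcome_eq:
  assumes "v \<in> positions n"
  shows "outcome \<sigma> v =
    (if wins \<sigma> Left Left v then if wins \<sigma> Right Right v then Out_N else Out_L
     else if wins \<sigma> Right Right v then Out_R else Out_P)"
proof -
  have other: "wins \<sigma> Left Right v \<longleftrightarrow> \<not> wins \<sigma> Right Right v"
    "wins \<sigma> Right Left v \<longleftrightarrow> \<not> wins \<sigma> Left Left v"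
    using wins_determined[OF assms, of \<sigma> Right Right] wins_determined[OF assms, of \<sigma> Left Left]
    by simp_all
  have all: "(\<forall>Y. P Y) \<longleftrightarrow> P Left \<and> P Right" for P
    by (metis player.exhaust)
  show ?thesis
    unfolding outcome_def
    by (rule the1_equality[OF ex1_outcome[OF assms]]) (simp add: all other)
qed

lemma left_threshold_eq:
  assumes "\<And>\<gamma>. left_replace w \<gamma> \<in> positions n"
  shows "left_threshold \<sigma> w = least_index (\<lambda>\<gamma>. \<not> wins \<sigma> Right Right (left_replace w \<gamma>))"
  by (simp add: left_threshold_def least_index_def outcome_eq[OF assms])

lemma right_threshold_eq:
  assumes "\<And>\<gamma>. right_replace \<sigma> w \<gamma> \<in> positions n"
  shows "right_threshold \<sigma> w = least_index (\<lambda>\<gamma>. \<not> wins \<sigma> Left Left (right_replace \<sigma> w \<gamma>))"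
  by (simp add: right_threshold_def least_index_def outcome_eq[OF assms])

lemma wins_Left_first_iff:
  assumes "w \<in> positions n"
  shows "wins \<sigma> Left Left w \<longleftrightarrow> (\<exists>a<\<alpha> w. \<not> wins \<sigma> Right Right (left_replace w a))"
proof -
  have "wins \<sigma> Left Right v \<longleftrightarrow> \<not> wins \<sigma> Right Right v" if "v \<in> options \<sigma> Left w" for v
    using wins_determined[OF options_decrease(1)[OF assms that], of \<sigma> Right Right] by simp
  then show ?thesis
    unfolding wins_self_iff[of \<sigma> Left] by (simp only: opponent.simps) auto
qed

lemma wins_Right_first_iff:
  assumes "w \<in> positions n"
  shows "wins \<sigma> Right Right w \<longleftrightarrow> (\<exists>b<\<beta> \<sigma> w. \<not> wins \<sigma> Left Left (right_replace \<sigma> w b))"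
proof -
  have "wins \<sigma> Right Left v \<longleftrightarrow> \<not> wins \<sigma> Left Left v" if "v \<in> options \<sigma> Right w" for v
    using wins_determined[OF options_decrease(1)[OF assms that], of \<sigma> Left Left] by simp
  then show ?thesis
    unfolding wins_self_iff[of \<sigma> Right] by (simp only: opponent.simps) auto
qed

section \<open>Stability of the targets\<close>

lemma left_target_nonempty: "0 < w i \<Longrightarrow> 0 < w (left_target w)"
  unfolding left_target_def by (rule LeastI)

lemma right_target_nonempty: "0 < w i \<Longrightarrow> 0 < w (right_target \<sigma> w)"
  unfolding right_target_def by (rule arg_min_natI)

text \<open>
  Filling an empty pile may create a preferred target, hence the hypotheses on the supports. For
  Right, injectivity of \<open>\<sigma>\<close> makes the target unique.
\<close>

lemma left_target_stable:
  assumes "\<And>i. 0 < v i \<Longrightarrow> 0 < w i" "0 < v (left_target w)"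
  shows "left_target v = left_target w"
  unfolding left_target_def[of v]
  by (rule Least_equality) (use assms in \<open>auto simp: left_target_def intro: Least_le\<close>)

lemma right_target_stable:
  assumes "inj \<sigma>" and "\<And>i. 0 < v i \<Longrightarrow> 0 < w i" "0 < v (right_target \<sigma> w)"
  shows "right_target \<sigma> v = right_target \<sigma> w"
proof -
  have "\<sigma> (right_target \<sigma> v) \<le> \<sigma> (right_target \<sigma> w)"
    unfolding right_target_def[of _ v] by (rule arg_min_nat_le) (fact assms(3))
  moreover have "\<sigma> (right_target \<sigma> w) \<le> \<sigma> (right_target \<sigma> v)"
    unfolding right_target_def[of _ w]
    by (rule arg_min_nat_le) (use assms right_target_nonempty in blast)
  ultimately show ?thesis
    using \<open>inj \<sigma>\<close> by (simp add: inj_eq)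
qed

section \<open>The thresholds of a position\<close>

lemma threshold_common_target:
  assumes "w \<in> positions_eq n \<sigma>" "inj \<sigma>"
  shows "left_threshold \<sigma> w =
      (case outcome \<sigma> (left_removed w) of Out_L \<Rightarrow> 0 | Out_R \<Rightarrow> \<infinity> | Out_P \<Rightarrow> 0 | Out_N \<Rightarrow> 1)"
    and "right_threshold \<sigma> w =
      (case outcome \<sigma> (left_removed w) of Out_L \<Rightarrow> \<infinity> | Out_R \<Rightarrow> 0 | Out_P \<Rightarrow> 0 | Out_N \<Rightarrow> 1)"
proof -
  define t where "t = left_target w"
  define v where "v c = w(t := c)" for c
  have t: "right_target \<sigma> w = t" and w: "w \<in> positions n"
    using assms by (simp_all add: t_def positions_eq_def positions_plus_def)
  obtain i where "0 < w i"
    using assms by (auto simp: positions_eq_def positions_plus_def terminal_def)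
  then have "0 < w t"
    unfolding t_def by (rule left_target_nonempty)
  then have v: "v c \<in> positions n" for c
    using w positive_entry_in_piles[OF w, of t] by (auto simp: v_def positions_def)
  have targets: "left_target (v c) = t" "right_target \<sigma> (v c) = t" if "0 < c" for c
    using that \<open>0 < w t\<close> left_target_stable[of "v c" w] right_target_stable[OF \<open>inj \<sigma>\<close>, of "v c" w]
    by (auto simp: v_def t simp flip: t_def split: if_splits)
  have L: "wins \<sigma> Left Left (v c) \<longleftrightarrow> (\<exists>c'<c. \<not> wins \<sigma> Right Right (v c'))"
    and R: "wins \<sigma> Right Right (v c) \<longleftrightarrow> (\<exists>c'<c. \<not> wins \<sigma> Left Left (v c'))" if "0 < c" for c
    using wins_Left_first_iff[OF v, of \<sigma> c] wins_Right_first_iff[OF v, of \<sigma> c] targets[OF that]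
    by (simp_all add: left_replace_def right_replace_def left_stones_def right_stones_def v_def)
  have repl: "left_replace w = v" "right_replace \<sigma> w = v"
    by (auto simp: left_replace_def right_replace_def v_def t simp flip: t_def)
  show "left_threshold \<sigma> w =
      (case outcome \<sigma> (left_removed w) of Out_L \<Rightarrow> 0 | Out_R \<Rightarrow> \<infinity> | Out_P \<Rightarrow> 0 | Out_N \<Rightarrow> 1)"
    using left_threshold_eq[of w n \<sigma>] one_pile_threshold[OF R] v
    by (simp add: left_removed_def repl outcome_eq[OF v])
  show "right_threshold \<sigma> w =
      (case outcome \<sigma> (left_removed w) of Out_L \<Rightarrow> \<infinity> | Out_R \<Rightarrow> 0 | Out_P \<Rightarrow> 0 | Out_N \<Rightarrow> 1)"
    using right_threshold_eq[of \<sigma> w n] one_pile_threshold[OF L] v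
    by (simp add: left_removed_def repl outcome_eq[OF v])
qed

lemma threshold_distinct_targets:
  assumes "w \<in> positions_neq n \<sigma>" "inj \<sigma>"
  shows "left_threshold \<sigma> w =
      (if enat (\<beta> \<sigma> w) \<le> right_threshold \<sigma> (left_removed w) then 0
       else left_threshold \<sigma> (right_removed \<sigma> w)
            + (enat (\<beta> \<sigma> w) - right_threshold \<sigma> (left_removed w)))"
    and "right_threshold \<sigma> w =
      (if enat (\<alpha> w) \<le> left_threshold \<sigma> (right_removed \<sigma> w) then 0
       else right_threshold \<sigma> (left_removed w)
            + (enat (\<alpha> w) - left_threshold \<sigma> (right_removed \<sigma> w)))"
proof -
  define l r where "l = left_target w" and "r = right_target \<sigma> w"
  define v where "v a b = w(l := a, r := b)" for a b
  have "l \<noteq> r" and w: "w \<in> positions n"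
    using assms by (simp_all add: l_def r_def positions_neq_def positions_plus_def)
  obtain i where "0 < w i"
    using assms by (auto simp: positions_neq_def positions_plus_def terminal_def)
  then have pos: "0 < w l" "0 < w r"
    unfolding l_def r_def by (rule left_target_nonempty, rule right_target_nonempty)
  then have v: "v a b \<in> positions n" for a b
    using w positive_entry_in_piles[OF w, of l] positive_entry_in_piles[OF w, of r]
    by (auto simp: v_def positions_def)
  have left: "left_target (v a b) = l" if "0 < a" for a b
    by (rule left_target_stable[of "v a b" w, folded l_def])
      (use that pos \<open>l \<noteq> r\<close> in \<open>auto simp: v_def split: if_splits\<close>)
  have right: "right_target \<sigma> (v a b) = r" if "0 < b" for a b
    by (rule right_target_stable[OF \<open>inj \<sigma>\<close>, of "v a b" w, folded r_def])
      (use that pos \<open>l \<noteq> r\<close> in \<open>auto simp: v_def split: if_splits\<close>)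
  have left_repl: "left_replace (v a b) = (\<lambda>a'. v a' b)" if "0 < a" for a b
    using \<open>l \<noteq> r\<close> by (intro ext) (simp add: left_replace_def left[OF that], simp add: v_def)
  have right_repl: "right_replace \<sigma> (v a b) = v a" if "0 < b" for a b
    by (intro ext) (simp add: right_replace_def right[OF that], simp add: v_def)
  have left_size: "\<alpha> (v a b) = a" if "0 < a" for a b
    using \<open>l \<noteq> r\<close> by (simp add: left_stones_def left[OF that], simp add: v_def)
  have right_size: "\<beta> \<sigma> (v a b) = b" if "0 < b" for a b
    by (simp add: right_stones_def right[OF that], simp add: v_def)
  have L: "wins \<sigma> Left Left (v a b) \<longleftrightarrow> (\<exists>a'<a. \<not> wins \<sigma> Right Right (v a' b))"
    if "0 < a" for a b
    using wins_Left_first_iff[OF v] by (simp add: left_repl[OF that] left_size[OF that])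
  have R: "wins \<sigma> Right Right (v a b) \<longleftrightarrow> (\<exists>b'<b. \<not> wins \<sigma> Left Left (v a b'))"
    if "0 < b" for a b
    using wins_Right_first_iff[OF v] by (simp add: right_repl[OF that] right_size[OF that])
  have "w = v (\<alpha> w) (\<beta> \<sigma> w)"
    by (simp add: v_def left_stones_def right_stones_def l_def r_def)
  moreover have stones: "0 < \<alpha> w" "0 < \<beta> \<sigma> w"
    using pos by (simp_all add: left_stones_def right_stones_def l_def r_def)
  ultimately have repl: "left_replace w = (\<lambda>a. v a (\<beta> \<sigma> w))" "right_replace \<sigma> w = v (\<alpha> w)"
    using left_repl right_repl by metis+
  \<comment> \<open>All four thresholds belong to the family \<open>v\<close>: those of \<open>w\<^sub>R\<close> and \<open>w\<^sub>L\<close> are read off its edges.\<close>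
  have thr: "left_threshold \<sigma> w = least_index (\<lambda>a. \<not> wins \<sigma> Right Right (v a (\<beta> \<sigma> w)))"
    "right_threshold \<sigma> w = least_index (\<lambda>b. \<not> wins \<sigma> Left Left (v (\<alpha> w) b))"
    "left_threshold \<sigma> (right_removed \<sigma> w) = least_index (\<lambda>a. \<not> wins \<sigma> Right Right (v a 0))"
    "right_threshold \<sigma> (left_removed w) = least_index (\<lambda>b. \<not> wins \<sigma> Left Left (v 0 b))"
    by (simp_all add: left_removed_def right_removed_def left_threshold_eq[where n = n]
        right_threshold_eq[where n = n] repl left_repl right_repl stones v)
  show "left_threshold \<sigma> w =
      (if enat (\<beta> \<sigma> w) \<le> right_threshold \<sigma> (left_removed w) then 0
       else left_threshold \<sigma> (right_removed \<sigma> w)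
            + (enat (\<beta> \<sigma> w) - right_threshold \<sigma> (left_removed w)))"
    unfolding thr
    by (rule two_pile_threshold[where F = "\<lambda>a b. wins \<sigma> Left Left (v a b)"
          and G = "\<lambda>a b. wins \<sigma> Right Right (v a b)"]) (fact L R stones)+
  show "right_threshold \<sigma> w =
      (if enat (\<alpha> w) \<le> left_threshold \<sigma> (right_removed \<sigma> w) then 0
       else right_threshold \<sigma> (left_removed w)
            + (enat (\<alpha> w) - left_threshold \<sigma> (right_removed \<sigma> w)))"
    unfolding thr
    by (rule two_pile_threshold[where F = "\<lambda>b a. wins \<sigma> Right Right (v a b)"
          and G = "\<lambda>b a. wins \<sigma> Left Left (v a b)"]) (fact L R stones)+
qed

lemma first_player_wins_iff_above_threshold:
  assumes "w \<in> positions_plus n"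
  shows "wins \<sigma> Left Left w \<longleftrightarrow> left_threshold \<sigma> w < enat (\<alpha> w)"
    and "wins \<sigma> Right Right w \<longleftrightarrow> right_threshold \<sigma> w < enat (\<beta> \<sigma> w)"
proof -
  have w: "w \<in> positions n"
    using assms by (simp add: positions_plus_def)
  obtain i where "0 < w i"
    using assms by (auto simp: positions_plus_def terminal_def)
  then have "0 < w (left_target w)" "0 < w (right_target \<sigma> w)"
    by (rule left_target_nonempty, rule right_target_nonempty)
  then have "left_target w \<in> {1..n}" "right_target \<sigma> w \<in> {1..n}"
    using positive_entry_in_piles[OF w] by blast+
  then have "left_replace w \<gamma> \<in> positions n" "right_replace \<sigma> w \<gamma> \<in> positions n" for \<gamma>
    using w by (auto simp: positions_def left_replace_def right_replace_def)
  then show "wins \<sigma> Left Left w \<longleftrightarrow> left_threshold \<sigma> w < enat (\<alpha> w)"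
    "wins \<sigma> Right Right w \<longleftrightarrow> right_threshold \<sigma> w < enat (\<beta> \<sigma> w)"
    using wins_Left_first_iff[OF w, of \<sigma>] wins_Right_first_iff[OF w, of \<sigma>]
    by (simp_all add: left_threshold_eq[where n = n] right_threshold_eq[where n = n]
        least_index_less_iff)
qed

section \<open>The threshold recursion and the outcome table\<close>

theorem theorem3p2:
  fixes n :: nat and \<sigma> :: "nat \<Rightarrow> nat" and w :: position
  assumes "1 \<le> n"
    and "\<sigma> permutes {1..n}"
    and "w \<in> positions_plus n"
  shows
    "(w \<in> positions_eq n \<sigma> \<longrightarrow>
        left_threshold \<sigma> w =
          (case outcome \<sigma> (left_removed w) of Out_L \<Rightarrow> 0 | Out_R \<Rightarrow> \<infinity> | Out_P \<Rightarrow> 0 | Out_N \<Rightarrow> 1) \<and>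
        right_threshold \<sigma> w =
          (case outcome \<sigma> (left_removed w) of Out_L \<Rightarrow> \<infinity> | Out_R \<Rightarrow> 0 | Out_P \<Rightarrow> 0 | Out_N \<Rightarrow> 1))
     \<and>
     (w \<in> positions_neq n \<sigma> \<longrightarrow>
        left_threshold \<sigma> w =
          (if enat (\<beta> \<sigma> w) \<le> right_threshold \<sigma> (left_removed w) then 0
           else left_threshold \<sigma> (right_removed \<sigma> w)
                + (enat (\<beta> \<sigma> w) - right_threshold \<sigma> (left_removed w))) \<and>
        right_threshold \<sigma> w =
          (if enat (\<alpha> w) \<le> left_threshold \<sigma> (right_removed \<sigma> w) then 0
           else right_threshold \<sigma> (left_removed w)
                + (enat (\<alpha> w) - left_threshold \<sigma> (right_removed \<sigma> w))))
     \<and>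
     (enat (\<alpha> w) > left_threshold \<sigma> w \<and> enat (\<beta> \<sigma> w) \<le> right_threshold \<sigma> w
        \<longrightarrow> outcome \<sigma> w = Out_L) \<and>
     (enat (\<alpha> w) \<le> left_threshold \<sigma> w \<and> enat (\<beta> \<sigma> w) > right_threshold \<sigma> w
        \<longrightarrow> outcome \<sigma> w = Out_R) \<and>
     (enat (\<alpha> w) > left_threshold \<sigma> w \<and> enat (\<beta> \<sigma> w) > right_threshold \<sigma> w
        \<longrightarrow> outcome \<sigma> w = Out_N) \<and>
     (enat (\<alpha> w) \<le> left_threshold \<sigma> w \<and> enat (\<beta> \<sigma> w) \<le> right_threshold \<sigma> w
        \<longrightarrow> outcome \<sigma> w = Out_P)"
proof -
  have "inj \<sigma>" and w: "w \<in> positions n"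
    using assms by (auto simp: positions_plus_def permutes_inj)
  note outcome_iff = outcome_eq[OF w] first_player_wins_iff_above_threshold[OF assms(3)]
  show ?thesis
  proof (intro conjI)
    show "w \<in> positions_eq n \<sigma> \<longrightarrow>
        left_threshold \<sigma> w =
          (case outcome \<sigma> (left_removed w) of Out_L \<Rightarrow> 0 | Out_R \<Rightarrow> \<infinity> | Out_P \<Rightarrow> 0 | Out_N \<Rightarrow> 1) \<and>
        right_threshold \<sigma> w =
          (case outcome \<sigma> (left_removed w) of Out_L \<Rightarrow> \<infinity> | Out_R \<Rightarrow> 0 | Out_P \<Rightarrow> 0 | Out_N \<Rightarrow> 1)"
      using threshold_common_target[OF _ \<open>inj \<sigma>\<close>] by blast
    show "w \<in> positions_neq n \<sigma> \<longrightarrow>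
        left_threshold \<sigma> w =
          (if enat (\<beta> \<sigma> w) \<le> right_threshold \<sigma> (left_removed w) then 0
           else left_threshold \<sigma> (right_removed \<sigma> w)
                + (enat (\<beta> \<sigma> w) - right_threshold \<sigma> (left_removed w))) \<and>
        right_threshold \<sigma> w =
          (if enat (\<alpha> w) \<le> left_threshold \<sigma> (right_removed \<sigma> w) then 0
           else right_threshold \<sigma> (left_removed w)
                + (enat (\<alpha> w) - left_threshold \<sigma> (right_removed \<sigma> w)))"
      using threshold_distinct_targets[OF _ \<open>inj \<sigma>\<close>] by blast
  qed (simp_all add: outcome_iff flip: not_less)
qed

end
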